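(* For every $k\in\{1,\dots,7\}$, there exists a caterpillar $T$ such that $\chi_p(T)=k$ and $\mu_p(T)=1$.
   Context: All graphs are finite and simple; the graph $T$ is connected (graphs obtained by deleting a vertex may be disconnected or empty). For a graph $G$, $d_G(u,v)$ is the length of a shortest $u$--$v$ path in $G$, with $d_G(u,v)=\infty$ if $u,v$ lie in different components. A packing coloring of $G$ with $k$ colors is a map $c:V(G)\to\{1,2,\dots,k\}$ such that for every $i\in\{1,\dots,k\}$, any two distinct vertices $u,v$ with $c(u)=c(v)=i$ satisfy $d_G(u,v)>i$. The packing chromatic number $\chi_p(G)$ is the minimum $k$ for which $G$ has such a coloring (the graph with no vertices has $\chi_p=0$, so the one-vertex graph has $\mu_p=1$). $G-v$ denotes the graph obtained by deleting the vertex $v$. The packing coloring gap of $G$ is $\mu_p(G)=\max_{v\in V(G)}\bigl(\chi_p(G)-\chi_p(G-v)\bigr)$. A caterpillar is a tree in which all vertices of degree at least two lie on a single path (the central path). *)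

theory Defs
  imports "Graph_Theory.Graph_Theory" "HOL-Library.Extended_Nat"
begin

text \<open>
  A finite simple graph is a digraph satisfying the locale predicate \<^const>\<open>graph\<close> (finite,
  symmetric, without loops or parallel arcs): each edge is a pair of opposite arcs, and the degree
  of a vertex is its out-degree. The graph without vertices is allowed.
\<close>

text \<open>The infimum over the empty set is \<open>\<infinity>\<close>, the distance between different components.\<close>

definition graph_dist :: "('a, 'b) pre_digraph \<Rightarrow> 'a \<Rightarrow> 'a \<Rightarrow> enat" where
  "graph_dist G u v = (INF p \<in> {p. pre_digraph.apath G u p v}. enat (length p))"

definition packing_coloring :: "('a, 'b) pre_digraph \<Rightarrow> nat \<Rightarrow> ('a \<Rightarrow> nat) \<Rightarrow> bool" where
  "packing_coloring G k c \<longleftrightarrow>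
     (\<forall>v\<in>verts G. c v \<in> {1..k}) \<and>
     (\<forall>i\<in>{1..k}. \<forall>u\<in>verts G. \<forall>v\<in>verts G.
        u \<noteq> v \<and> c u = i \<and> c v = i \<longrightarrow> graph_dist G u v > enat i)"

definition packing_chromatic_number :: "('a, 'b) pre_digraph \<Rightarrow> nat" where
  "packing_chromatic_number G = (LEAST k. \<exists>c. packing_coloring G k c)"

text \<open>Integer-valued, so that the subtraction does not truncate.\<close>

definition packing_coloring_gap :: "('a, 'b) pre_digraph \<Rightarrow> int" where
  "packing_coloring_gap G =
     Max ((\<lambda>v. int (packing_chromatic_number G)
               - int (packing_chromatic_number (pre_digraph.del_vert G v))) ` verts G)"

text \<open>
  The constant \<^const>\<open>tree\<close> is not usable for undirected trees: traversing an edge back and forth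
  counts as a cycle of length 2 there. In a simple graph the undirected cycles are exactly the
  cycles of length at least 3.
\<close>

definition undirected_tree :: "('a, 'b) pre_digraph \<Rightarrow> bool" where
  "undirected_tree G \<longleftrightarrow>
     graph G \<and> connected G \<and> \<not> (\<exists>p. pre_digraph.cycle G p \<and> length p \<ge> 3)"

definition caterpillar :: "('a, 'b) pre_digraph \<Rightarrow> bool" where
  "caterpillar G \<longleftrightarrow>
     undirected_tree G \<and>
     (\<exists>u p v. pre_digraph.apath G u p v \<and>
        {w \<in> verts G. out_degree G w \<ge> 2} \<subseteq> set (pre_digraph.awalk_verts G u p))"

end

theory Submission
  imports Defs
begin

text \<open>
  Everything takes place inside one infinite caterpillar: a one-way infinite spine with six leaves
  at every spine vertex. As long as only \<open>k \<le> 6\<close> colours are used, six leaves keep colour 1 off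
  their spine vertex: otherwise the leaves, which are pairwise at distance 2, would need six
  different colours from \<open>{2..k}\<close>. Hence a spine segment with all
  its leaves is \<open>k\<close>-colourable only if its sites can be labelled with colours from
  \<open>{2..k}\<close> so that two sites with the same label \<open>c\<close> are more than \<open>c\<close> apart (\<open>spaced\<close>).
  A finite search shows that this fails for 2, 3, 5, 9, 35 sites when \<open>k = 2, 3, 4, 5, 6\<close>
  respectively. In particular a segment of 35 sites needs seven colours.

  The trees for \<open>k = 4, ..., 7\<close> come from a discrete continuity argument. Start from a subtree that is
  \<open>(k - 1)\<close>-colourable and contains two disjoint segments that both need \<open>k - 1\<close> colours
  already; it is given by an explicit list of spine colours. Add the vertices of the 35-site segment
  one at a time, each after its parent. Every step adds a leaf, so it leaves the old distances alone
  and costs at most one new colour. At the first moment when \<open>k - 1\<close> colours do not suffice, the tree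
  \<open>T\<close> has packing chromatic number exactly \<open>k\<close>, and removing the vertex added last gives
  \<open>k - 1\<close>. Removing any other vertex spares one of the two disjoint segments, so it still leaves a
  graph that needs \<open>k - 1\<close> colours. Hence the gap is exactly 1 (\<open>gap_one_caterpillar_of_pattern\<close>).
  For \<open>k = 1, 2, 3\<close> the paths with 1, 2 and 4 vertices do.

  Distances are never computed from paths. In the infinite caterpillar they have a closed form,
  which bounds from below the distances in every subgraph and is attained in the connected ones
  (\<open>graph_dist_comb_ge\<close>, \<open>graph_dist_comb\<close>). Colourability thereby becomes arithmetic.
\<close>

section \<open>The infinite caterpillar and its finite subgraphs\<close>

text \<open>
  The vertices of the infinite caterpillar are the natural numbers: \<open>7 * s\<close> is the spine vertex of
  site \<open>s\<close>, and \<open>7 * s + 1, ..., 7 * s + 6\<close> are its leaves. The parent of a vertex is always smaller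
  than the vertex itself, so growing a tree in numerical order adds leaves only.
\<close>

definition leg :: "nat \<Rightarrow> nat" where
  "leg v = (if 7 dvd v then 0 else 1)"

text \<open>
  The distance in the infinite caterpillar. Truncated subtraction is used in both directions, so
  that the two differences add up to the absolute difference of the sites.
\<close>

definition comb_dist :: "nat \<Rightarrow> nat \<Rightarrow> nat" where
  "comb_dist u v = (if u = v then 0
     else (u div 7 - v div 7) + (v div 7 - u div 7) + leg u + leg v)"

text \<open>The subgraph induced by \<open>V\<close>; its edges are the pairs at distance 1.\<close>

definition comb :: "nat set \<Rightarrow> (nat, nat \<times> nat) pre_digraph" where
  "comb V = \<lparr>verts = V, arcs = {(u, v). u \<in> V \<and> v \<in> V \<and> comb_dist u v = 1}, tail = fst, head = snd\<rparr>"

lemma comb_simps [simp]: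
  "verts (comb V) = V"
  "arcs (comb V) = {(u, v). u \<in> V \<and> v \<in> V \<and> comb_dist u v = 1}"
  "tail (comb V) = fst" "head (comb V) = snd"
  by (simp_all add: comb_def)

lemma del_vert_comb: "pre_digraph.del_vert (comb V) v = comb (V - {v})"
  by (auto simp: pre_digraph.del_vert_def comb_def)

lemma comb_dist_self [simp]: "comb_dist u u = 0"
  by (simp add: comb_dist_def)

lemma comb_dist_commute: "comb_dist u v = comb_dist v u"
  by (simp add: comb_dist_def)

lemma comb_dist_triangle: "comb_dist u w \<le> comb_dist u v + comb_dist v w"
proof -
  have "(a - c) + (c - a) \<le> (a - b) + (b - a) + ((b - c) + (c - b))" for a b c :: nat
    by arith
  from this[of "u div 7" "w div 7" "v div 7"] show ?thesis
    by (simp add: comb_dist_def)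
qed

lemma spine_eqI: "7 dvd u \<Longrightarrow> 7 dvd v \<Longrightarrow> u div 7 = v div 7 \<Longrightarrow> u = (v::nat)"
  by auto

lemma comb_dist_pos: "u \<noteq> v \<Longrightarrow> 0 < comb_dist u v"
  using spine_eqI[of u v] by (simp add: comb_dist_def leg_def) (metis less_linear)

lemma comb_dist_spine: "comb_dist (7 * i) (7 * j) = (i - j) + (j - i)"
  by (simp add: comb_dist_def leg_def)

lemma graph_comb:
  assumes "finite V"
  shows "graph (comb V)"
proof -
  have fin: "finite (arcs (comb V))"
    by (rule finite_subset[of _ "V \<times> V"]) (use assms in auto)
  have "digraph (comb V)"
    by unfold_locales (use assms fin in \<open>auto simp: arc_to_ends_def\<close>)
  moreover have "symmetric (comb V)"
    by (auto simp: symmetric_def sym_def arcs_ends_conv comb_dist_commute image_iff)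
  ultimately show ?thesis
    by (rule digraph.graphI)
qed

text \<open>
  Any two vertices of such a set are joined inside it by their path in the infinite caterpillar.
  For \<open>u = w\<close> the condition says that a leaf comes with the spine vertex it hangs on.
\<close>

definition spine_convex :: "nat set \<Rightarrow> bool" where
  "spine_convex V \<longleftrightarrow> (\<forall>u\<in>V. \<forall>w\<in>V. \<forall>s. u div 7 \<le> s \<and> s \<le> w div 7 \<longrightarrow> 7 * s \<in> V)"

section \<open>Distances in the subgraphs\<close>

text \<open>
  By the triangle inequality the formula drops by at most one along each arc.
\<close>

lemma comb_dist_le_walk:
  assumes "pre_digraph.cas (comb V) u p w" "set p \<subseteq> arcs (comb V)"
  shows "comb_dist u w \<le> length p"
  using assms
proof (induction p arbitrary: u)
  case Nil
  then show ?case by (simp add: pre_digraph.cas.simps)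
next
  case (Cons e p)
  then have e: "fst e = u" "comb_dist u (snd e) = 1" and "comb_dist (snd e) w \<le> length p"
    by (auto simp: pre_digraph.cas.simps)
  then show ?case
    using comb_dist_triangle[of u w "snd e"] by simp
qed

text \<open>
  Conversely, convexity provides a neighbour one step closer to the target: a leaf moves to its spine
  vertex, a spine vertex moves along the spine or descends to the target leaf.
\<close>

lemma closer_neighbour:
  assumes "spine_convex V" "u \<in> V" "w \<in> V" "u \<noteq> w"
  obtains u' where "u' \<in> V" "comb_dist u u' = 1" "comb_dist u w = Suc (comb_dist u' w)"
proof -
  have between: "7 * s \<in> V" if "u div 7 \<le> s \<and> s \<le> w div 7 \<or> w div 7 \<le> s \<and> s \<le> u div 7" for s
    using assms that unfolding spine_convex_def by blast
  consider "\<not> 7 dvd u" | "7 dvd u" "u div 7 < w div 7" | "7 dvd u" "w div 7 < u div 7"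
    | "7 dvd u" "u div 7 = w div 7" by linarith
  then show thesis
  proof cases
    case 1
    then have "u \<noteq> 7 * (u div 7)"
      by (metis dvd_triv_left)
    show ?thesis
    proof (rule that)
      show "7 * (u div 7) \<in> V"
        using assms unfolding spine_convex_def by blast
    qed (use 1 \<open>u \<noteq> 7 * (u div 7)\<close> assms in \<open>auto simp: comb_dist_def leg_def\<close>)
  next
    case 2
    then show ?thesis
      using between[of "Suc (u div 7)"]
      by (intro that[of "7 * Suc (u div 7)"]) (auto simp: comb_dist_def leg_def)
  next
    case 3
    then have "w div 7 \<le> u div 7 - 1" "u div 7 - 1 \<le> u div 7"
      by linarith+
    with 3 show ?thesis
      using between[of "u div 7 - 1"] assms(2)
      by (intro that[of "7 * (u div 7 - 1)"]) (auto simp: comb_dist_def leg_def)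
  next
    case 4
    then show ?thesis
      using assms by (intro that[of w]) (auto simp: comb_dist_def leg_def)
  qed
qed

text \<open>
  Following closer neighbours gives a walk of the right length. The last conjunct is what keeps the
  walk a path: the start is farther from the target than every later vertex.
\<close>

lemma geodesic_exists:
  assumes "finite V" "spine_convex V" "u \<in> V" "w \<in> V"
  shows "\<exists>p. pre_digraph.apath (comb V) u p w \<and> length p = comb_dist u w \<and>
    (\<forall>x\<in>set (pre_digraph.awalk_verts (comb V) u p). comb_dist x w \<le> comb_dist u w)"
  using \<open>u \<in> V\<close>
proof (induction "comb_dist u w" arbitrary: u)
  case 0
  interpret graph "comb V" by (rule graph_comb) fact
  from 0 have "u = w" by (metis comb_dist_pos less_irrefl)
  with 0 show ?case
    by (intro exI[of _ "[]"]) (auto simp: apath_Nil_iff)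
next
  case (Suc n)
  interpret graph "comb V" by (rule graph_comb) fact
  from Suc have "u \<noteq> w" by auto
  then obtain u' where u': "u' \<in> V" "comb_dist u u' = 1" "comb_dist u w = Suc (comb_dist u' w)"
    using closer_neighbour assms Suc by metis
  obtain p where p: "apath u' p w" "length p = comb_dist u' w"
      "\<forall>x\<in>set (awalk_verts u' p). comb_dist x w \<le> comb_dist u' w"
    using Suc.hyps u' by (metis nat.inject)
  then show ?case
    using u' Suc by (intro exI[of _ "(u, u') # p"]) (auto simp: apath_Cons_iff)
qed

lemma graph_dist_comb_ge: "enat (comb_dist u w) \<le> graph_dist (comb V) u w"
  unfolding graph_dist_def
  by (rule INF_greatest)
    (use comb_dist_le_walk in \<open>auto simp: pre_digraph.apath_def pre_digraph.awalk_def\<close>)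

lemma graph_dist_comb:
  assumes "finite V" "spine_convex V" "u \<in> V" "w \<in> V"
  shows "graph_dist (comb V) u w = enat (comb_dist u w)"
proof (rule antisym)
  obtain p where "pre_digraph.apath (comb V) u p w" "length p = comb_dist u w"
    using geodesic_exists[OF assms] by blast
  then show "graph_dist (comb V) u w \<le> enat (comb_dist u w)"
    unfolding graph_dist_def by (metis (mono_tags, lifting) INF_lower mem_Collect_eq)
qed (rule graph_dist_comb_ge)

lemma connected_comb:
  assumes "finite V" "spine_convex V" "V \<noteq> {}"
  shows "connected (comb V)"
proof -
  interpret graph "comb V" by (rule graph_comb) fact
  have "u \<rightarrow>\<^sup>*\<^bsub>comb V\<^esub> w" if "u \<in> V" "w \<in> V" for u w
    using geodesic_exists[OF assms(1,2) that] reachable_apath by blast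
  then show ?thesis
    using assms reachable_mk_symmetricI
    by (auto simp: connected_def strongly_connected_def mk_symmetric_def)
qed

section \<open>The subgraphs are caterpillars\<close>

text \<open>
  A vertex has only one smaller neighbour, its parent in the tree rooted at 0.
\<close>

lemma smaller_neighbour:
  assumes "comb_dist u v = 1" "v < u"
  shows "v = (if 7 dvd u then u - 7 else 7 * (u div 7))"
proof -
  define a r b s where "a = u div 7" "r = u mod 7" "b = v div 7" "s = v mod 7"
  then have uv: "u = 7 * a + r" "v = 7 * b + s" and "7 dvd u \<longleftrightarrow> r = 0" "7 dvd v \<longleftrightarrow> s = 0"
    by (simp_all add: dvd_eq_mod_eq_0)
  then have "(a - b) + (b - a) + (if r = 0 then 0 else 1) + (if s = 0 then 0 else 1) = (1::nat)"
    using assms \<open>a = u div 7\<close> \<open>b = v div 7\<close> by (simp add: comb_dist_def leg_def)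
  moreover have "b \<le> a"
    unfolding \<open>a = _\<close> \<open>b = _\<close> using assms by (simp add: div_le_mono)
  ultimately have "v = (if r = 0 then u - 7 else 7 * a)"
    using \<open>v < u\<close> unfolding uv by (auto split: if_splits)
  then show ?thesis
    using \<open>7 dvd u \<longleftrightarrow> r = 0\<close> \<open>a = _\<close> by simp
qed

text \<open>
  The largest vertex of a cycle of length at least 3 would have two different smaller neighbours,
  namely its predecessor and its successor on the cycle.
\<close>

lemma no_long_cycle_comb:
  assumes "length p \<ge> 3"
  shows "\<not> pre_digraph.cycle (comb V) p"
proof
  assume "pre_digraph.cycle (comb V) p"
  then obtain u where cas: "pre_digraph.cas (comb V) u p u" and arcs: "set p \<subseteq> arcs (comb V)"
    and dist: "distinct (tl (pre_digraph.awalk_verts (comb V) u p))"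
    by (auto simp: pre_digraph.cycle_def pre_digraph.awalk_def)
  define n where "n = length p"
  define y where "y i = snd (p ! i)" for i
  have verts: "pre_digraph.awalk_verts (comb V) v q = v # map snd q"
    if "pre_digraph.cas (comb V) v q w" for v q w
    using that by (induction q arbitrary: v) (auto simp: pre_digraph.cas.simps pre_digraph.awalk_verts.simps)
  have "distinct (map snd p)"
    using dist verts[OF cas] by simp
  then have y_inj: "y i = y j \<Longrightarrow> i < n \<Longrightarrow> j < n \<Longrightarrow> i = j" for i j
    by (auto simp: distinct_conv_nth y_def n_def)
  have consecutive: "fst (q ! Suc i) = snd (q ! i)"
    if "pre_digraph.cas (comb V) v q w" "Suc i < length q" for v q w i
    using that
  proof (induction q arbitrary: v i)
    case (Cons e q)
    then show ?case
      by (cases q; cases i) (auto simp: pre_digraph.cas.simps)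
  qed simp
  have first: "fst (q ! 0) = v" and last: "snd (q ! (length q - 1)) = w"
    if "pre_digraph.cas (comb V) v q w" "q \<noteq> []" for v q w
    using that
    by (induction q arbitrary: v) (auto simp: pre_digraph.cas.simps nth_Cons')
  have nonempty: "p \<noteq> []"
    using assms by auto
  have y_step: "fst (p ! (if Suc i = n then 0 else Suc i)) = y i" if "i < n" for i
  proof (cases "Suc i = n")
    case True
    then have "length p - 1 = i"
      by (simp add: n_def)
    then show ?thesis
      using first[OF cas nonempty] last[OF cas nonempty] True by (simp add: y_def)
  next
    case False
    then show ?thesis
      using that consecutive[OF cas, of i] by (simp add: y_def n_def)
  qed
  have adjacent: "comb_dist (fst (p ! i)) (y i) = 1" if "i < n" for i
    using arcs that nth_mem[of i p] by (fastforce simp: y_def n_def)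
  obtain j where j: "j < n" "\<And>i. i < n \<Longrightarrow> y i \<le> y j"
  proof -
    have "finite (y ` {..<n})" "y ` {..<n} \<noteq> {}"
      using nonempty by (auto simp: n_def lessThan_empty_iff)
    then have "Max (y ` {..<n}) \<in> y ` {..<n}"
      by (rule Max_in)
    then obtain j where "j < n" "y j = Max (y ` {..<n})"
      by auto
    then show thesis
      by (intro that[of j]) auto
  qed
  \<comment> \<open>The arcs of the cycle are \<open>(y pred, y j)\<close> and \<open>(y j, y succ)\<close> around its largest vertex.\<close>
  define pred succ where "pred = (if j = 0 then n - 1 else j - 1)"
    and "succ = (if Suc j = n then 0 else Suc j)"
  have range: "pred < n" "succ < n" and "pred \<noteq> succ"
    using j(1) assms by (auto simp: pred_def succ_def n_def)
  have "fst (p ! j) = y pred" "fst (p ! succ) = y j"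
    using y_step[of pred] y_step[of j] j(1) range by (auto simp: pred_def succ_def split: if_splits)
  then have adj: "comb_dist (y j) (y pred) = 1" "comb_dist (y j) (y succ) = 1"
    using adjacent[OF j(1)] adjacent[OF range(2)] by (simp_all add: comb_dist_commute)
  then have "y pred \<noteq> y j" "y succ \<noteq> y j"
    by auto
  then have "y pred < y j" "y succ < y j"
    using j(2) range by (simp_all add: order_neq_le_trans)
  then have "y pred = y succ"
    using smaller_neighbour[OF adj(1)] smaller_neighbour[OF adj(2)] by simp
  with y_inj range \<open>pred \<noteq> succ\<close> show False
    by blast
qed

lemma spine_path_exists:
  assumes "\<And>s. a \<le> s \<Longrightarrow> s \<le> a + n \<Longrightarrow> 7 * s \<in> V"
  shows "\<exists>p. pre_digraph.apath (comb V) (7 * a) p (7 * (a + n)) \<and>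
    set (pre_digraph.awalk_verts (comb V) (7 * a) p) = (\<lambda>s. 7 * s) ` {a..a + n}"
  using assms
proof (induction n arbitrary: a)
  case 0
  then show ?case
    by (intro exI[of _ "[]"])
      (auto simp: pre_digraph.apath_def pre_digraph.awalk_def pre_digraph.cas.simps
        pre_digraph.awalk_verts.simps)
next
  case (Suc n)
  have "\<And>s. Suc a \<le> s \<Longrightarrow> s \<le> Suc a + n \<Longrightarrow> 7 * s \<in> V"
    using Suc.prems by simp
  then obtain p where p: "pre_digraph.apath (comb V) (7 * Suc a) p (7 * (Suc a + n))"
    "set (pre_digraph.awalk_verts (comb V) (7 * Suc a) p) = (\<lambda>s. 7 * s) ` {Suc a..Suc a + n}"
    using Suc.IH by blast
  have "comb_dist (7 * a) (7 * Suc a) = 1"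
    unfolding comb_dist_spine by simp
  moreover have "7 * a \<in> V" "7 * Suc a \<in> V"
    by (rule Suc.prems; simp)+
  moreover have "{a..a + Suc n} = insert a {Suc a..Suc a + n}"
    by auto
  ultimately show ?case
    using p
    by (intro exI[of _ "(7 * a, 7 * Suc a) # p"])
      (auto simp: pre_digraph.apath_def pre_digraph.awalk_def pre_digraph.cas.simps
        pre_digraph.awalk_verts.simps)
qed

lemma leaf_neighbour:
  assumes "comb_dist w v = 1" "\<not> 7 dvd w"
  shows "v = 7 * (w div 7)"
proof (cases "v < w")
  case True
  with assms show ?thesis
    using smaller_neighbour[of w v] by simp
next
  case False
  have "w \<noteq> v"
    using assms by auto
  with False have "w < v"
    by simp
  then have "w = (if 7 dvd v then v - 7 else 7 * (v div 7))"
    using assms smaller_neighbour by (simp add: comb_dist_commute)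
  then have "7 dvd w"
    by (auto split: if_splits)
  with assms show ?thesis
    by simp
qed

text \<open>The whole spine serves as the central path.\<close>

lemma caterpillar_comb:
  assumes "finite V" "spine_convex V" "0 \<in> V"
  shows "caterpillar (comb V)"
proof -
  have "undirected_tree (comb V)"
    using assms graph_comb connected_comb no_long_cycle_comb
    unfolding undirected_tree_def by blast
  moreover have "\<exists>u p v. pre_digraph.apath (comb V) u p v \<and>
      {w \<in> verts (comb V). out_degree (comb V) w \<ge> 2}
        \<subseteq> set (pre_digraph.awalk_verts (comb V) u p)"
  proof -
    define m where "m = Max ((\<lambda>v. v div 7) ` V)"
    have le_m: "v div 7 \<le> m" if "v \<in> V" for v
      using assms(1) that by (simp add: m_def)
    have "m \<in> (\<lambda>v. v div 7) ` V"
      unfolding m_def using assms by (intro Max_in) auto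
    then obtain v where "v \<in> V" "v div 7 = m"
      by blast
    then have "7 * s \<in> V" if "s \<le> m" for s
      using that assms unfolding spine_convex_def by (metis div_0 le0)
    then obtain p where p: "pre_digraph.apath (comb V) (7 * 0) p (7 * (0 + m))"
      "set (pre_digraph.awalk_verts (comb V) (7 * 0) p) = (\<lambda>s. 7 * s) ` {0..0 + m}"
      using spine_path_exists[of 0 m V] by auto
    have "w \<in> (\<lambda>s. 7 * s) ` {0..0 + m}" if "w \<in> V" "out_degree (comb V) w \<ge> 2" for w
    proof -
      have "7 dvd w"
      proof (rule ccontr)
        assume "\<not> 7 dvd w"
        then have "out_arcs (comb V) w \<subseteq> {(w, 7 * (w div 7))}"
          using leaf_neighbour by (auto simp: out_arcs_def)
        then have "card (out_arcs (comb V) w) \<le> 1"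
          using card_mono[of "{(w, 7 * (w div 7))}"] by simp
        with that(2) show False
          by (simp add: out_degree_def)
      qed
      then show ?thesis
        using le_m[OF that(1)] by auto
    qed
    with p show ?thesis
      by (intro exI conjI) auto
  qed
  ultimately show ?thesis
    by (simp add: caterpillar_def)
qed

section \<open>Packing colourings of the subgraphs\<close>

definition packing_colorable :: "nat set \<Rightarrow> nat \<Rightarrow> bool" where
  "packing_colorable V k \<longleftrightarrow> (\<exists>c. packing_coloring (comb V) k c)"

lemma packing_coloring_comb_iff:
  "packing_coloring (comb V) k c \<longleftrightarrow> (\<forall>v\<in>V. c v \<in> {1..k}) \<and>
    (\<forall>u\<in>V. \<forall>v\<in>V. u \<noteq> v \<longrightarrow> c u = c v \<longrightarrow> enat (c u) < graph_dist (comb V) u v)"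
  (is "_ \<longleftrightarrow> ?range \<and> ?far")
proof (intro iffI conjI)
  assume c: "packing_coloring (comb V) k c"
  then show ?range
    by (simp add: packing_coloring_def)
  show ?far
  proof (intro ballI impI)
    fix u v assume "u \<in> V" "v \<in> V" "u \<noteq> v" "c u = c v"
    moreover from this c have "c u \<in> {1..k}"
      by (simp add: packing_coloring_def)
    ultimately show "enat (c u) < graph_dist (comb V) u v"
      using c by (simp add: packing_coloring_def)
  qed
next
  assume *: "?range \<and> ?far"
  have "enat i < graph_dist (comb V) u v"
    if "u \<in> V" "v \<in> V" "u \<noteq> v \<and> c u = i \<and> c v = i" for i u v
    using * that by force
  with * show "packing_coloring (comb V) k c"
    unfolding packing_coloring_def comb_simps by (intro conjI ballI impI) (use * in \<open>blast+\<close>)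
qed

text \<open>
  For a sufficient condition the closed form may replace the distance in every subgraph, since it is
  a lower bound; for the converse, \<open>packing_colorableE\<close>, the subgraph has to be convex.
\<close>

lemma packing_colorableI:
  assumes "\<And>v. v \<in> V \<Longrightarrow> c v \<in> {1..k}"
    and "\<And>u v. u \<in> V \<Longrightarrow> v \<in> V \<Longrightarrow> u \<noteq> v \<Longrightarrow> c u = c v \<Longrightarrow> c u < comb_dist u v"
  shows "packing_colorable V k"
proof -
  have "enat (c u) < graph_dist (comb V) u v"
    if "u \<in> V" "v \<in> V" "u \<noteq> v" "c u = c v" for u v
    using assms(2)[OF that] graph_dist_comb_ge[of u v V]
    by (meson enat_ord_simps(2) less_le_trans)
  with assms(1) have "packing_coloring (comb V) k c"
    unfolding packing_coloring_comb_iff by simp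
  then show ?thesis
    unfolding packing_colorable_def by blast
qed

lemma packing_colorableE:
  assumes "packing_colorable V k" "finite V" "spine_convex V"
  obtains c where "\<And>v. v \<in> V \<Longrightarrow> c v \<in> {1..k}"
    and "\<And>u v. u \<in> V \<Longrightarrow> v \<in> V \<Longrightarrow> u \<noteq> v \<Longrightarrow> c u = c v \<Longrightarrow> c u < comb_dist u v"
proof -
  obtain c where c: "packing_coloring (comb V) k c"
    using assms unfolding packing_colorable_def by blast
  show thesis
  proof (rule that[of c])
    show "c v \<in> {1..k}" if "v \<in> V" for v
      using c that unfolding packing_coloring_comb_iff by blast
    show "c u < comb_dist u v" if "u \<in> V" "v \<in> V" "u \<noteq> v" "c u = c v" for u v
    proof -
      have "enat (c u) < graph_dist (comb V) u v"
        using c that by (simp add: packing_coloring_comb_iff)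
      then show ?thesis
        using graph_dist_comb[OF assms(2,3)] that by simp
    qed
  qed
qed

lemma graph_dist_subset:
  assumes "W \<subseteq> V"
  shows "graph_dist (comb V) u w \<le> graph_dist (comb W) u w"
proof -
  have "subgraph (comb W) (comb V)"
    using assms by (auto simp: subgraph_def compatible_def wf_digraph_def)
  moreover have "wf_digraph (comb V)"
    by (auto simp: wf_digraph_def)
  ultimately have "pre_digraph.apath (comb V) u p w" if "pre_digraph.apath (comb W) u p w" for p
    using that by (metis wf_digraph.subgraph_apath_imp_apath)
  then show ?thesis
    unfolding graph_dist_def by (intro INF_superset_mono) auto
qed

text \<open>Passing to a subgraph only increases distances.\<close>

lemma packing_colorable_subset:
  assumes "packing_colorable V k" "W \<subseteq> V"
  shows "packing_colorable W k"
proof -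
  obtain c where c: "packing_coloring (comb V) k c"
    using assms unfolding packing_colorable_def by blast
  have "enat (c u) < graph_dist (comb W) u v"
    if "u \<in> W" "v \<in> W" "u \<noteq> v" "c u = c v" for u v
    using c that assms(2) less_le_trans[OF _ graph_dist_subset[OF assms(2)]]
    by (simp add: packing_coloring_comb_iff subset_iff)
  moreover have "c v \<in> {1..k}" if "v \<in> W" for v
    using c that assms(2) unfolding packing_coloring_comb_iff by blast
  ultimately have "packing_coloring (comb W) k c"
    by (simp add: packing_coloring_comb_iff)
  then show ?thesis
    unfolding packing_colorable_def by blast
qed

lemma packing_colorable_mono:
  assumes "packing_colorable V k" "k \<le> l"
  shows "packing_colorable V l"
proof -
  obtain c where "packing_coloring (comb V) k c"
    using assms unfolding packing_colorable_def by blast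
  then have "packing_coloring (comb V) l c"
    using assms(2) by (simp add: packing_coloring_comb_iff) (meson order_trans)
  then show ?thesis
    unfolding packing_colorable_def by blast
qed

text \<open>
  The new vertex gets a colour of its own. The distances between old vertices do not shrink: the
  closed form gives them before the insertion and bounds them from below afterwards.
\<close>

lemma packing_colorable_insert:
  assumes "packing_colorable V k" "finite V" "spine_convex V"
  shows "packing_colorable (insert x V) (Suc k)"
proof -
  obtain c where "\<And>v. v \<in> V \<Longrightarrow> c v \<in> {1..k}"
    and "\<And>u v. u \<in> V \<Longrightarrow> v \<in> V \<Longrightarrow> u \<noteq> v \<Longrightarrow> c u = c v \<Longrightarrow> c u < comb_dist u v"
    using packing_colorableE[OF assms] by blast
  note c = this
  show ?thesis
  proof (rule packing_colorableI[of _ "c(x := Suc k)"])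
    show "(c(x := Suc k)) v \<in> {1..Suc k}" if "v \<in> insert x V" for v
      using c(1)[of v] that by auto
    show "(c(x := Suc k)) u < comb_dist u v"
      if "u \<in> insert x V" "v \<in> insert x V" "u \<noteq> v" "(c(x := Suc k)) u = (c(x := Suc k)) v" for u v
      using c(1)[of u] c(1)[of v] c(2)[of u v] that by (auto split: if_splits)
  qed
qed

lemma packing_chromatic_number_le:
  "packing_colorable V k \<Longrightarrow> packing_chromatic_number (comb V) \<le> k"
  unfolding packing_chromatic_number_def packing_colorable_def by (rule Least_le)

lemma less_packing_chromatic_number:
  assumes "packing_colorable V l" "\<not> packing_colorable V k"
  shows "k < packing_chromatic_number (comb V)"
proof -
  have "packing_colorable V (packing_chromatic_number (comb V))"
    using assms(1) unfolding packing_chromatic_number_def packing_colorable_def by (rule LeastI)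
  then show ?thesis
    using assms(2) packing_colorable_mono not_le by blast
qed

text \<open>
  The criterion behind all seven trees. Removing \<open>x\<close> lowers the number of colours by one. No vertex
  lowers it further, because it can meet only one of the disjoint sets \<open>A\<close> and \<open>B\<close>, each of which
  needs \<open>k - 1\<close> colours.
\<close>

lemma comb_gap_oneI:
  assumes "k \<ge> 1" and V: "finite V" "spine_convex V" "0 \<in> V"
    and x: "x \<in> V" "spine_convex (V - {x})"
    and col: "packing_colorable (V - {x}) (k - 1)" "\<not> packing_colorable V (k - 1)"
    and AB: "A \<subseteq> V" "B \<subseteq> V" "A \<inter> B = {}"
    and AB_col: "k \<ge> 2 \<Longrightarrow> \<not> packing_colorable A (k - 2) \<and> \<not> packing_colorable B (k - 2)"
  shows "caterpillar (comb V) \<and> packing_chromatic_number (comb V) = k \<and>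
    packing_coloring_gap (comb V) = 1"
proof -
  have col_k: "packing_colorable V k"
    using packing_colorable_insert[OF col(1), of x] V(1) x \<open>k \<ge> 1\<close> by (simp add: insert_absorb)
  then have chi: "packing_chromatic_number (comb V) = k"
    using packing_chromatic_number_le less_packing_chromatic_number[OF col_k col(2)]
    by (metis Suc_pred' Suc_leI assms(1) le_antisym less_eq_Suc_le One_nat_def)
  have ge: "k - 1 \<le> packing_chromatic_number (comb (V - {v}))" for v
  proof (cases "k \<ge> 2")
    case True
    have "\<not> packing_colorable (V - {v}) (k - 2)"
    proof
      assume "packing_colorable (V - {v}) (k - 2)"
      moreover have "A \<subseteq> V - {v} \<or> B \<subseteq> V - {v}"
        using AB by blast
      ultimately show False
        using packing_colorable_subset AB_col[OF True] by blast
    qed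
    moreover have "packing_colorable (V - {v}) k"
      using packing_colorable_subset[OF col_k] by blast
    ultimately show ?thesis
      using less_packing_chromatic_number by fastforce
  qed simp
  have "packing_coloring_gap (comb V) = 1"
    unfolding packing_coloring_gap_def
  proof (rule Max_eqI)
    show "y \<le> 1" if y: "y \<in> (\<lambda>v. int (packing_chromatic_number (comb V)) -
        int (packing_chromatic_number (pre_digraph.del_vert (comb V) v))) ` verts (comb V)" for y
    proof -
      obtain v where "y = int k - int (packing_chromatic_number (comb (V - {v})))"
        using y by (auto simp: chi del_vert_comb)
      then show ?thesis
        using ge[of v] \<open>k \<ge> 1\<close> by linarith
    qed
    have "packing_chromatic_number (comb (V - {x})) = k - 1"
      using ge[of x] packing_chromatic_number_le[OF col(1)] by simp
    then show "1 \<in> (\<lambda>v. int (packing_chromatic_number (comb V)) -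
        int (packing_chromatic_number (pre_digraph.del_vert (comb V) v))) ` verts (comb V)"
      using \<open>k \<ge> 1\<close> x(1) by (intro image_eqI[of _ _ x]) (auto simp: chi del_vert_comb)
  qed (use V in simp)
  with chi V caterpillar_comb show ?thesis
    by blast
qed

section \<open>Colouring the spine of a fully leafed segment\<close>

text \<open>
  Equal entries \<open>c\<close> of the list are more than \<open>c\<close> positions apart; see \<open>spaced_iff\<close>.
\<close>

fun spaced :: "nat list \<Rightarrow> bool" where
  "spaced [] = True"
| "spaced (c # w) \<longleftrightarrow> c \<notin> set (take c w) \<and> spaced w"

lemma spaced_iff:
  "spaced w \<longleftrightarrow> (\<forall>i j. i < j \<longrightarrow> j < length w \<longrightarrow> w ! i = w ! j \<longrightarrow> w ! i < j - i)"
proof (induction w)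
  case (Cons c w)
  have "c \<notin> set (take c w) \<longleftrightarrow> (\<forall>j. j < length w \<longrightarrow> c = w ! j \<longrightarrow> c < Suc j)"
    by (auto simp: in_set_conv_nth not_less_eq[symmetric])
  then have "spaced (c # w) \<longleftrightarrow> (\<forall>j. j < length w \<longrightarrow> c = w ! j \<longrightarrow> c < Suc j) \<and>
      (\<forall>i j. i < j \<longrightarrow> j < length w \<longrightarrow> w ! i = w ! j \<longrightarrow> w ! i < j - i)"
    using Cons.IH by simp
  also have "\<dots> \<longleftrightarrow> (\<forall>i j. i < j \<longrightarrow> j < length (c # w) \<longrightarrow>
      (c # w) ! i = (c # w) ! j \<longrightarrow> (c # w) ! i < j - i)" (is "?L \<longleftrightarrow> ?R")
  proof
    assume L: ?L
    show ?R
    proof (intro allI impI)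
      fix i j assume "i < j" "j < length (c # w)" "(c # w) ! i = (c # w) ! j"
      with L show "(c # w) ! i < j - i"
        by (cases i; cases j) auto
    qed
  next
    assume R: ?R
    show ?L
    proof (intro conjI allI impI)
      show "c < Suc j" if "j < length w" "c = w ! j" for j
        using R[rule_format, of 0 "Suc j"] that by simp
      show "w ! i < j - i" if "i < j" "j < length w" "w ! i = w ! j" for i j
        using R[rule_format, of "Suc i" "Suc j"] that by simp
    qed
  qed
  finally show ?case .
qed simp

text \<open>
  Exhaustive search: a spaced list \<open>w\<close> cannot be extended to the left by \<open>n\<close> further entries from
  \<open>cs\<close>. The conditional stands for a disjunction. It makes evaluation skip the second disjunct once
  the first one holds, and so prunes the search tree.
\<close>

fun stuck :: "nat list \<Rightarrow> nat \<Rightarrow> nat list \<Rightarrow> bool" where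
  "stuck cs 0 w = False"
| "stuck cs (Suc n) w \<longleftrightarrow>
     list_all (\<lambda>c. if c \<in> set (take c w) then True else stuck cs n (c # w)) cs"

lemma spaced_suffix: "spaced (us @ w) \<Longrightarrow> spaced w"
  by (induction us) auto

lemma stuck_no_extension:
  assumes "stuck cs (length us) w" "set us \<subseteq> set cs"
  shows "\<not> spaced (us @ w)"
  using assms
proof (induction us arbitrary: w rule: rev_induct)
  case (snoc c us)
  show ?case
  proof
    assume spaced: "spaced ((us @ [c]) @ w)"
    then have "c \<notin> set (take c w)"
      using spaced_suffix[of us "c # w"] by simp
    then have "stuck cs (length us) (c # w)"
      using snoc.prems by (auto simp: list_all_iff split: if_splits)
    with snoc spaced show False
      by simp
  qed
qed simp

lemma spine_convex_segment: "spine_convex {7 * a..<7 * (a + n)}"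
proof -
  have "7 * s \<in> {7 * a..<7 * (a + n)}"
    if "u \<in> {7 * a..<7 * (a + n)}" "w \<in> {7 * a..<7 * (a + n)}" "u div 7 \<le> s" "s \<le> w div 7" for u w s
  proof -
    have "a \<le> u div 7" "w div 7 < a + n"
      using that(1,2) by (simp_all add: less_eq_div_iff_mult_less_eq div_less_iff_less_mult)
    with that(3,4) show ?thesis
      by simp
  qed
  then show ?thesis
    unfolding spine_convex_def by blast
qed

text \<open>
  The six leaves of a site have pairwise distance 2. If their spine vertex had colour 1, they would
  need six different colours from \<open>{2..k}\<close>, which has at most five elements. So all spine vertices
  have colours in \<open>{2..k}\<close>, and these form a spaced list.
\<close>

lemma spine_colours_of_segment:
  assumes "packing_colorable {7 * a..<7 * (a + n)} k" "k \<le> 6"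
  obtains xs where "length xs = n" "spaced xs" "set xs \<subseteq> {2..k}"
proof -
  let ?V = "{7 * a..<7 * (a + n)}"
  obtain c where range: "\<And>v. v \<in> ?V \<Longrightarrow> c v \<in> {1..k}"
    and far: "\<And>u v. u \<in> ?V \<Longrightarrow> v \<in> ?V \<Longrightarrow> u \<noteq> v \<Longrightarrow> c u = c v \<Longrightarrow> c u < comb_dist u v"
    using packing_colorableE[OF assms(1) _ spine_convex_segment] by blast
  have not_one: "c (7 * s) \<noteq> 1" if s: "a \<le> s" "s < a + n" for s
  proof
    assume one: "c (7 * s) = 1"
    let ?L = "{7 * s + 1..7 * s + 6}"
    have L: "?L \<subseteq> ?V" "7 * s \<in> ?V"
      using s by auto
    have leaf: "v div 7 = s" "leg v = 1" if "v \<in> ?L" for v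
    proof -
      from that show "v div 7 = s"
        by (auto simp: div_nat_eqI)
      with that show "leg v = 1"
        by (auto simp: leg_def)
    qed
    have "c v \<in> {2..k}" if "v \<in> ?L" for v
    proof -
      have "v \<noteq> 7 * s"
        using that by simp
      then have "comb_dist v (7 * s) = 1"
        using leaf[OF that] by (simp add: comb_dist_def) (simp add: leg_def)
      moreover have "c v < comb_dist v (7 * s)" if "c v = 1"
        using L \<open>v \<in> ?L\<close> \<open>v \<noteq> 7 * s\<close> one that by (intro far) auto
      ultimately have "c v \<noteq> 1"
        by auto
      moreover have "c v \<in> {1..k}"
        using that L(1) by (intro range) (rule subsetD)
      ultimately show ?thesis
        by auto
    qed
    then have image: "c ` ?L \<subseteq> {2..k}"
      by blast
    have "inj_on c ?L"
    proof (rule inj_onI, rule ccontr)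
      fix u v assume uv: "u \<in> ?L" "v \<in> ?L" "c u = c v" "u \<noteq> v"
      then have "c u < comb_dist u v"
        using L by (intro far) blast+
      also have "\<dots> = 2"
        using uv leaf by (simp add: comb_dist_def)
      finally show False
        using subsetD[OF image imageI[OF uv(1)]] by simp
    qed
    then have "card ?L \<le> card {2..k}"
      using image by (metis card_image card_mono finite_atLeastAtMost)
    with assms(2) show False
      by simp
  qed
  show thesis
  proof (rule that)
    let ?xs = "map (\<lambda>i. c (7 * (a + i))) [0..<n]"
    show "length ?xs = n"
      by simp
    show "set ?xs \<subseteq> {2..k}"
    proof
      fix x assume "x \<in> set ?xs"
      then obtain i where i: "i < n" "x = c (7 * (a + i))"
        by auto
      then have "c (7 * (a + i)) \<in> {1..k}"
        by (intro range) auto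
      with not_one[of "a + i"] i show "x \<in> {2..k}"
        by auto
    qed
    show "spaced ?xs"
      unfolding spaced_iff
    proof (intro allI impI)
      fix i j assume ij: "i < j" "j < length ?xs" "?xs ! i = ?xs ! j"
      then have "c (7 * (a + i)) < comb_dist (7 * (a + i)) (7 * (a + j))"
        by (intro far) auto
      with ij show "?xs ! i < j - i"
        unfolding comb_dist_spine by simp
    qed
  qed
qed

lemma full_segment_not_colorable:
  assumes "stuck [2..<Suc k] n []" "k \<le> 6"
  shows "\<not> packing_colorable {7 * a..<7 * (a + n)} k"
proof
  assume "packing_colorable {7 * a..<7 * (a + n)} k"
  then obtain xs where "length xs = n" "spaced xs" "set xs \<subseteq> {2..k}"
    using spine_colours_of_segment assms(2) by blast
  then show False
    using stuck_no_extension[of "[2..<Suc k]" xs "[]"] assms(1)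
    by (simp add: atLeastLessThanSuc_atLeastAtMost del: upt_Suc)
qed

text \<open>
  The colours \<open>2, ..., 6\<close> do not suffice for the spine of a segment with 35 sites. Comparing
  densities cannot show this, as \<open>1/3 + 1/4 + 1/5 + 1/6 + 1/7 > 1\<close>.
\<close>

lemma long_spine_stuck: "stuck [2..<Suc 6] 35 []"
  by code_simp

section \<open>Growing a tree from a spine pattern\<close>

text \<open>
  The list \<open>cs\<close> gives the colours of the spine, and a site carries its six leaves exactly if its
  colour is not 1. All leaves can then be coloured 1.
\<close>

definition pattern_verts :: "nat list \<Rightarrow> nat set" where
  "pattern_verts cs = {v. v div 7 < length cs \<and> (7 dvd v \<or> cs ! (v div 7) \<noteq> 1)}"

lemma pattern_verts_subset: "pattern_verts cs \<subseteq> {..<7 * length cs}"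
  by (auto simp: pattern_verts_def div_less_iff_less_mult)

lemma pattern_colorable:
  assumes "spaced cs" "set cs \<subseteq> {1..k}" "k \<ge> 1"
  shows "packing_colorable (pattern_verts cs) k"
proof -
  define c where "c v = (if 7 dvd v then cs ! (v div 7) else 1)" for v
  show ?thesis
  proof (rule packing_colorableI)
    show "c v \<in> {1..k}" if "v \<in> pattern_verts cs" for v
      using that assms(2,3) subsetD[OF assms(2) nth_mem[of "v div 7" cs]]
      by (auto simp: c_def pattern_verts_def)
    show "c u < comb_dist u v"
      if uv: "u \<in> pattern_verts cs" "v \<in> pattern_verts cs" "u \<noteq> v" "c u = c v" for u v
    proof (cases "7 dvd u \<and> 7 dvd v")
      case True
      then obtain i j where ij: "u = 7 * i" "v = 7 * j"
        by (auto elim!: dvdE)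
      then have "i < length cs" "j < length cs" "i \<noteq> j" "cs ! i = cs ! j"
        using uv by (auto simp: pattern_verts_def c_def)
      then have "cs ! i < (i - j) + (j - i)"
        using assms(1) unfolding spaced_iff
        by (cases i j rule: linorder_cases) (auto, metis)
      with ij show ?thesis
        by (simp add: c_def comb_dist_spine)
    next
      case False
      then have "c u = 1"
        using uv(4) by (auto simp: c_def)
      have spine_not_one: "c (7 * (w div 7)) \<noteq> 1" if "w \<in> pattern_verts cs" "\<not> 7 dvd w" for w
        using that by (simp add: pattern_verts_def c_def)
      have "comb_dist u v \<noteq> 1"
      proof
        assume adj: "comb_dist u v = 1"
        show False
        proof (cases "7 dvd u")
          case True
          with False have "\<not> 7 dvd v"
            by simp
          then have "u = 7 * (v div 7)"
            using adj leaf_neighbour[of v u] comb_dist_commute[of v u] by simp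
          with spine_not_one[of v] \<open>\<not> 7 dvd v\<close> uv(2) \<open>c u = 1\<close> show False
            by metis
        next
          case False
          then have "v = 7 * (u div 7)"
            using adj leaf_neighbour by blast
          with spine_not_one[of u] False uv(1,4) \<open>c u = 1\<close> show False
            by metis
        qed
      qed
      with \<open>c u = 1\<close> show ?thesis
        using comb_dist_pos[OF uv(3)] by linarith
    qed
  qed
qed

text \<open>
  Both parts contain, with any vertex, all spine vertices up to its site.
\<close>

lemma spine_convex_pattern_Un:
  "spine_convex (pattern_verts cs \<union> {..<n})"
proof -
  have "7 * s \<in> pattern_verts cs \<union> {..<n}"
    if "w \<in> pattern_verts cs \<union> {..<n}" "s \<le> w div 7" for w s
  proof (cases "w < n")
    case True
    have "7 * s \<le> w"
      using that(2) by (simp add: less_eq_div_iff_mult_less_eq)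
    with True show ?thesis
      by simp
  next
    case False
    with that show ?thesis
      by (auto simp: pattern_verts_def)
  qed
  then show ?thesis
    unfolding spine_convex_def by blast
qed

text \<open>
  The discrete continuity argument. The sites of \<open>as\<close> and \<open>bs\<close> carry all their leaves, so each of
  these blocks of \<open>m\<close> sites needs \<open>k - 1\<close> colours; these are the disjoint sets in
  \<open>comb_gap_oneI\<close>. The part \<open>mid\<close> only connects them.
\<close>

lemma gap_one_caterpillar_of_pattern:
  assumes k: "2 \<le> k" "k \<le> 7"
    and cs: "cs = as @ mid @ bs" "spaced cs" "set cs \<subseteq> {1..k - 1}"
    and blocks: "length as = m" "length bs = m" "1 \<notin> set as" "1 \<notin> set bs"
    and stuck: "stuck [2..<k - 1] m []"
  shows "\<exists>T :: (nat, nat \<times> nat) pre_digraph.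
    caterpillar T \<and> packing_chromatic_number T = k \<and> packing_coloring_gap T = 1"
proof -
  define V where "V n = pattern_verts cs \<union> {..<n}" for n
  have finite: "finite (V n)" for n
    unfolding V_def using pattern_verts_subset finite_subset by blast
  have convex: "spine_convex (V n)" for n
    unfolding V_def by (rule spine_convex_pattern_Un)
  have "packing_colorable (V 0) (k - 1)"
    using pattern_colorable[of cs "k - 1"] cs k by (simp add: V_def)
  moreover have "\<not> packing_colorable (V (7 * 35)) (k - 1)"
  proof
    assume "packing_colorable (V (7 * 35)) (k - 1)"
    then have "packing_colorable (V (7 * 35)) 6"
      using k by (elim packing_colorable_mono) simp
    moreover have "{7 * 0..<7 * (0 + 35)} \<subseteq> V (7 * 35)"
      by (auto simp: V_def)
    ultimately show False
      using full_segment_not_colorable[of 6 35 0] long_spine_stuck packing_colorable_subset by auto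
  qed
  \<comment> \<open>The vertex \<open>n\<close> is the one whose addition makes \<open>k - 1\<close> colours insufficient.\<close>
  ultimately obtain n where n: "packing_colorable (V n) (k - 1)"
      "\<not> packing_colorable (V (Suc n)) (k - 1)"
    using nat_induct[of "\<lambda>n. packing_colorable (V n) (k - 1)" "7 * 35"] by blast
  then have "V n \<noteq> V (Suc n)"
    by metis
  then have "n \<notin> V n"
    by (auto simp: V_def lessThan_Suc)
  then have remove: "V (Suc n) - {n} = V n"
    by (auto simp: V_def lessThan_Suc)
  have "m \<noteq> 0"
    using stuck by (cases m) auto
  define a where "a = length (as @ mid)"
  define A B where "A = {7 * 0..<7 * (0 + m)}" and "B = {7 * a..<7 * (a + m)}"
  have "cs ! i \<noteq> 1" if "i < m \<or> a \<le> i \<and> i < a + m" for i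
  proof -
    have "cs ! i \<in> set as \<union> set bs"
      using that blocks by (auto simp: cs(1) a_def nth_append)
    with blocks show ?thesis
      by auto
  qed
  moreover have "length cs = a + m" "m \<le> a"
    using blocks by (simp_all add: cs(1) a_def)
  ultimately have "A \<subseteq> pattern_verts cs" "B \<subseteq> pattern_verts cs"
    by (auto simp: A_def B_def pattern_verts_def div_less_iff_less_mult less_eq_div_iff_mult_less_eq)
  then have sub: "A \<subseteq> V (Suc n)" "B \<subseteq> V (Suc n)"
    by (auto simp: V_def)
  have "k - 1 = Suc (k - 2)"
    using k by simp
  then have "\<not> packing_colorable A (k - 2)" "\<not> packing_colorable B (k - 2)"
    unfolding A_def B_def using stuck k by (intro full_segment_not_colorable; simp)+
  moreover have "A \<inter> B = {}"
    using \<open>m \<le> a\<close> by (auto simp: A_def B_def)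
  moreover have "0 \<in> V (Suc n)" "n \<in> V (Suc n)"
    by (simp_all add: V_def)
  ultimately show ?thesis
    using k finite n sub convex
    by (intro exI[of _ "comb (V (Suc n))"] comb_gap_oneI[of k _ n A B]) (simp_all add: remove)
qed

section \<open>The seven caterpillars\<close>

lemma edge_not_1_colorable:
  assumes "packing_colorable V 1" "finite V" "spine_convex V" "u \<in> V" "v \<in> V" "comb_dist u v = 1"
  shows False
proof -
  obtain c where c: "\<And>v. v \<in> V \<Longrightarrow> c v \<in> {1..1::nat}"
    and far: "\<And>u v. u \<in> V \<Longrightarrow> v \<in> V \<Longrightarrow> u \<noteq> v \<Longrightarrow> c u = c v \<Longrightarrow> c u < comb_dist u v"
    using packing_colorableE[OF assms(1-3)] by blast
  have "u \<noteq> v" using assms(6) by auto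
  then show False
    using c[of u] c[of v] far[of u v] assms by auto
qed

lemma packing_colorable_0_iff: "packing_colorable V 0 \<longleftrightarrow> V = {}"
  by (auto simp: packing_colorable_def packing_coloring_comb_iff)

theorem theorem2:
  shows "\<forall>k \<in> {1..7::nat}. \<exists>T :: (nat, nat \<times> nat) pre_digraph.
    caterpillar T \<and> packing_chromatic_number T = k \<and> packing_coloring_gap T = 1"
proof
  fix k :: nat assume "k \<in> {1..7}"
  then have "k \<in> {1, 2, 3, 4, 5, 6, 7}"
    by (simp only: atLeastAtMost_iff insert_iff empty_iff) linarith
  then consider "k = 1" | "k = 2" | "k = 3" | "k = 4" | "k = 5" | "k = 6" | "k = 7"
    by blast
  then show "\<exists>T :: (nat, nat \<times> nat) pre_digraph.
    caterpillar T \<and> packing_chromatic_number T = k \<and> packing_coloring_gap T = 1"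
  proof cases
    case 1
    show ?thesis
      using comb_gap_oneI[of 1 "{0}" 0 "{}" "{}"] 1
      by (auto simp: packing_colorable_0_iff spine_convex_def)
  next
    case 2
    have "\<not> packing_colorable {0, 1} 1"
      using edge_not_1_colorable[of "{0, 1}" 0 1]
      by (auto simp: comb_dist_def leg_def spine_convex_def)
    moreover have "packing_colorable {0} 1"
      by (rule packing_colorableI[of _ "\<lambda>_. 1"]) auto
    moreover have "{0, 1} - {1} = {0::nat}" by auto
    ultimately show ?thesis
      using comb_gap_oneI[of 2 "{0, 1}" 1 "{0}" "{1}"] 2
      by (auto simp: packing_colorable_0_iff spine_convex_def)
  next
    case 3
    \<comment> \<open>The path \<open>1 - 0 - 7 - 8\<close>; its two end edges are disjoint.\<close>
    have "\<not> packing_colorable {0, 1} 1" "\<not> packing_colorable {7, 8} 1"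
      using edge_not_1_colorable[of "{0, 1}" 0 1] edge_not_1_colorable[of "{7, 8}" 7 8]
      by (auto simp: comb_dist_def leg_def spine_convex_def)
    moreover have conv: "spine_convex {0, 1, 7, 8}" "spine_convex {0, 1, 7}"
      by (auto simp: spine_convex_def le_Suc_eq)
    moreover have "\<not> packing_colorable {0, 1, 7, 8} 2"
    proof
      assume "packing_colorable {0, 1, 7, 8} 2"
      then obtain c where range: "\<And>v. v \<in> {0, 1, 7, 8} \<Longrightarrow> c v \<in> {1..2::nat}"
        and far: "\<And>u v. u \<in> {0, 1, 7, 8} \<Longrightarrow> v \<in> {0, 1, 7, 8} \<Longrightarrow> u \<noteq> v \<Longrightarrow> c u = c v \<Longrightarrow>
          c u < comb_dist u v"
        using packing_colorableE[OF _ _ conv(1)] by blast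
      have "comb_dist 0 7 = 1" "comb_dist 1 0 = 1" "comb_dist 8 7 = 1" "comb_dist 1 7 = 2"
        "comb_dist 8 0 = 2"
        by (simp_all add: comb_dist_def leg_def)
      then show False
        using far[of 0 7] far[of 1 0] far[of 8 7] far[of 1 7] far[of 8 0]
          range[of 0] range[of 1] range[of 7] range[of 8]
        by (simp, presburger)
    qed
    moreover have "packing_colorable {0, 1, 7} 2"
    proof (rule packing_colorableI[of _ "\<lambda>v. if v = 0 then 2 else 1"])
      have "comb_dist 1 7 = 2" "comb_dist 7 1 = 2"
        by (simp_all add: comb_dist_def leg_def)
      then show "(if u = 0 then 2 else 1) < comb_dist u v"
        if "u \<in> {0, 1, 7}" "v \<in> {0, 1, 7}" "u \<noteq> v"
          "(if u = 0 then 2 else 1) = (if v = 0 then 2 else (1::nat))" for u v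
        using that by auto
    qed auto
    moreover have "{0, 1, 7, 8} - {8} = {0, 1, 7::nat}" by auto
    ultimately show ?thesis
      unfolding 3
      by (intro exI[of _ "comb {0, 1, 7, 8}"] comb_gap_oneI[of 3 _ 8 "{0, 1}" "{7, 8}"]) simp_all
  next
    \<comment> \<open>In the patterns below, the outer blocks are just too long for the colours \<open>{2..k - 2}\<close>. The
      middle part, where present, keeps equal colours of the two blocks far enough apart.\<close>
    case 4
    show ?thesis
      unfolding 4
      by (rule gap_one_caterpillar_of_pattern[of 4 _ "[2, 3]" "[1, 2, 1]" "[3, 2]" 2, OF _ _ refl])
        (simp_all, code_simp)
  next
    case 5
    show ?thesis
      unfolding 5
      by (rule gap_one_caterpillar_of_pattern[of 5 _ "[3, 4, 2]" "[1]" "[3, 2, 4]" 3, OF _ _ refl])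
        (simp_all, code_simp)
  next
    case 6
    show ?thesis
      unfolding 6
      by (rule gap_one_caterpillar_of_pattern[of 6 _ "[2, 3, 4, 2, 5]" "[1]" "[2, 3, 4, 2, 5]" 5, OF _ _ refl])
        (simp_all, code_simp)
  next
    case 7
    show ?thesis
      unfolding 7
      by (rule gap_one_caterpillar_of_pattern[of 7 _ "[2, 3, 4, 2, 5, 3, 2, 4, 6]" "[]"
            "[2, 3, 5, 2, 4, 3, 2, 6, 5]" 9, OF _ _ refl])
        (simp_all, code_simp)
  qed
qed

end
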